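(* Let $\mathbb{F}$ be a field and let $A \in \mathbb{M}_{m,n}$, $B \in \mathbb{M}_{n,p}$, $C \in \mathbb{M}_{p,q}$ be matrices over $\mathbb{F}$. Then $$\operatorname{rank}(ABC) + \operatorname{rank}(B) = \operatorname{rank}(AB) + \operatorname{rank}(BC)$$ if and only if $$\operatorname{Rg}(B)\cap \operatorname{Ker}(A) = \operatorname{Rg}(BC)\cap \operatorname{Ker}(A).$$
   Context: $\mathbb{M}_{m,n}$ denotes the space of $m \times n$ matrices over the field $\mathbb{F}$. For a matrix $M \in \mathbb{M}_{m,n}$, $\operatorname{Rg}(M) = \{Mx : x \in \mathbb{F}^n\} \subseteq \mathbb{F}^m$ is its range (column space) and $\operatorname{Ker}(M) = \{x \in \mathbb{F}^n : Mx = 0\}$ is its kernel. *)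

theory Defs
  imports "Jordan_Normal_Form.DL_Rank" "Jordan_Normal_Form.Matrix_Kernel"
begin

definition mat_range :: "'a::field mat \<Rightarrow> 'a vec set" where
  "mat_range M = {M *\<^sub>v x | x. x \<in> carrier_vec (dim_col M)}"

(* The first argument of vec_space.rank is the dimension of the ambient space
   of the columns, hence the number of rows. *)
abbreviation mat_rank :: "'a::field mat \<Rightarrow> nat" where
  "mat_rank M \<equiv> vec_space.rank (dim_row M) M"

end

theory Submission
  imports Defs
begin

text \<open>By rank-nullity for the restriction of \<open>A\<close> to the range of \<open>B\<close>,
  \<open>rank (A B) + dim (Rg B \<inter> Ker A) = rank B\<close>. The same identity with \<open>B C\<close> in place of \<open>B\<close> turns
  the rank equation into \<open>dim (Rg B \<inter> Ker A) = dim (Rg (B C) \<inter> Ker A)\<close>. As the second of these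
  spaces is contained in the first, equal dimensions mean equal spaces.\<close>

text \<open>An independent subset of \<open>W\<close> is independent in the whole space as well, so
  it has at most \<open>dim\<close> elements. Hence a maximal one exists, and it is a finite basis
  of \<open>W\<close>.\<close>

lemma (in vectorspace) fin_dim_subspace:
  assumes fin_dim and W: "subspace K W V"
  shows "vectorspace.fin_dim K (vs W)"
proof -
  interpret W: vectorspace K "vs W"
    using W by (rule subspace_is_vs)
  have sub: "submodule K W V" and WV: "W \<subseteq> carrier V"
    using W by (auto simp: subspace_def submodule_def)
  have li: "W.lin_indpt S \<longleftrightarrow> lin_indpt S" if "S \<subseteq> W" for S
    using span_li_not_depend(2)[OF that sub] by simp
  have "\<exists>S. finite S \<and> maximal S (\<lambda>S. S \<subseteq> carrier (vs W) \<and> W.lin_indpt S)"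
  proof (rule maximal_exists)
    fix S assume "S \<subseteq> carrier (vs W) \<and> W.lin_indpt S"
    then have "S \<subseteq> carrier V" "lin_indpt S"
      using li WV by auto
    then show "finite S \<and> card S \<le> dim"
      using li_le_dim[OF \<open>fin_dim\<close>] by blast
  next
    \<comment> \<open>The search for a maximal set needs some independent set to start from.\<close>
    show "{} \<subseteq> carrier (vs W) \<and> W.lin_indpt {}"
      by (auto simp: W.lin_dep_def)
  qed
  then obtain S where "finite S" "W.basis S"
    using W.max_li_is_basis by blast
  then show ?thesis
    unfolding W.fin_dim_def W.basis_def by blast
qed

text \<open>A basis of \<open>W\<close> stays independent in the whole space and has
  \<open>dim\<close> elements, so it is a basis there too. Its span is then both \<open>W\<close>
  and the full carrier.\<close>

lemma (in vectorspace) subspace_eq_carrier_if_dim_eq: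
  assumes fin_dim and W: "subspace K W V" and dim: "vectorspace.dim K (vs W) = dim"
  shows "W = carrier V"
proof -
  interpret W: vectorspace K "vs W"
    using W by (rule subspace_is_vs)
  have sub: "submodule K W V" and WV: "W \<subseteq> carrier V"
    using W by (auto simp: subspace_def submodule_def)
  obtain S where S: "finite S" "W.basis S"
    using W.finite_basis_exists[OF fin_dim_subspace[OF assms(1,2)]] by blast
  then have SW: "S \<subseteq> W" and "W.lin_indpt S" and "W.span S = W"
    by (auto simp: W.basis_def)
  then have "lin_indpt S" and span: "span S = W"
    using span_li_not_depend[OF SW sub] by auto
  moreover have "card S = dim"
    using W.dim_basis[OF S] dim by simp
  ultimately have "basis S"
    using dim_li_is_basis[OF \<open>fin_dim\<close> \<open>finite S\<close>] SW WV by auto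
  then show ?thesis
    using span by (simp add: basis_def)
qed

text \<open>This is the previous lemma with \<open>vs W\<close> as the ambient space. Replacing the
  carrier twice leaves only the last replacement, so \<open>U\<close> inside \<open>vs W\<close> is
  the same structure as \<open>vs U\<close>.\<close>

lemma (in vectorspace) dim_eq_iff_if_subset:
  assumes fin_dim and U: "subspace K U V" and W: "subspace K W V" and "U \<subseteq> W"
  shows "vectorspace.dim K (vs U) = vectorspace.dim K (vs W) \<longleftrightarrow> U = W"
proof -
  have "subspace K U (vs W)"
    using W U \<open>U \<subseteq> W\<close> by (rule nested_subspaces)
  from vectorspace.subspace_eq_carrier_if_dim_eq[OF subspace_is_vs[OF W] fin_dim_subspace[OF \<open>fin_dim\<close> W] this]
  show ?thesis
    by auto
qed

text \<open>Connects the range, an image of vectors, with the span of the columns, whose dimension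
  defines \<open>vec_space.rank\<close>.\<close>

lemma mat_range_eq_span_cols:
  fixes A :: "'a::field mat"
  assumes "A \<in> carrier_mat n nc"
  shows "mat_range A = LinearCombinations.module.span class_ring (module_vec TYPE('a) n) (set (cols A))"
proof -
  interpret vec_space "TYPE('a)" n .
  show ?thesis
    using col_space_eq[OF assms] assms by (auto simp: col_space_def mat_range_def)
qed

lemma subspace_mat_range:
  fixes A :: "'a::field mat"
  assumes "A \<in> carrier_mat n nc"
  shows "VectorSpace.subspace class_ring (mat_range A) (module_vec TYPE('a) n)"
proof -
  interpret vec_space "TYPE('a)" n .
  show ?thesis
    unfolding mat_range_eq_span_cols[OF assms]
    using assms cols_dim[of A] by (intro span_is_subspace) simp
qed

lemma mat_rank_eq_dim_mat_range:
  fixes A :: "'a::field mat"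
  assumes "A \<in> carrier_mat n nc"
  shows "mat_rank A = vectorspace.dim class_ring (module_vec TYPE('a) n\<lparr>carrier := mat_range A\<rparr>)"
  using assms by (simp add: vec_space.rank_def mat_range_eq_span_cols[OF assms])

lemma mat_range_mult:
  assumes "A \<in> carrier_mat m n" and "B \<in> carrier_mat n p"
  shows "mat_range (A * B) = (*\<^sub>v) A ` mat_range B"
proof -
  have "A * B *\<^sub>v x = A *\<^sub>v (B *\<^sub>v x)" if "x \<in> carrier_vec p" for x
    using assms that by (rule assoc_mult_mat_vec)
  then show ?thesis
    using assms by (simp add: mat_range_def Setcompr_eq_image image_image)
qed

lemma mat_range_mult_subset:
  assumes A: "A \<in> carrier_mat m n" and B: "B \<in> carrier_mat n p"
  shows "mat_range (A * B) \<subseteq> mat_range A"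
proof -
  have "mat_range B \<subseteq> carrier_vec n"
    using B by (auto simp: mat_range_def)
  then show ?thesis
    using A unfolding mat_range_mult[OF A B] by (auto simp: mat_range_def)
qed

text \<open>The domain is cut down to the range of \<open>B\<close> so that the kernel of the map
  becomes \<open>mat_range B \<inter> mat_kernel A\<close> and its image becomes
  \<open>mat_range (A * B)\<close>.\<close>

lemma linear_map_mat_range:
  fixes A B :: "'a::field mat"
  assumes A: "A \<in> carrier_mat m n" and B: "B \<in> carrier_mat n p"
  shows "linear_map class_ring (module_vec TYPE('a) n\<lparr>carrier := mat_range B\<rparr>)
    (module_vec TYPE('a) m) ((*\<^sub>v) A)"
proof -
  interpret N: vec_space "TYPE('a)" n .
  interpret M: vec_space "TYPE('a)" m .
  interpret R: vectorspace class_ring "N.vs (mat_range B)"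
    using subspace_mat_range[OF B] by (rule N.subspace_is_vs)
  have carrier: "x \<in> carrier_vec n" if "x \<in> mat_range B" for x
    using that B by (auto simp: mat_range_def)
  have "(*\<^sub>v) A \<in> LinearCombinations.module_hom class_ring (N.vs (mat_range B)) M.V"
    unfolding LinearCombinations.module_hom_def module_vec_simps
    using mult_mat_vec_carrier[OF A carrier] mult_add_distrib_mat_vec[OF A carrier carrier]
      mult_mat_vec[OF A carrier] by (simp add: module_vec_simps)
  then show ?thesis
    by (intro linear_map.intro mod_hom.intro mod_hom_axioms.intro
      R.vectorspace_axioms R.module_axioms M.vectorspace_axioms M.module_axioms vec_vs vec_module)
qed

lemma rank_mult_add_dim_range_inter_kernel:
  fixes A B :: "'a::field mat"
  assumes A: "A \<in> carrier_mat m n" and B: "B \<in> carrier_mat n p"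
  defines "U \<equiv> mat_range B \<inter> mat_kernel A"
  shows "VectorSpace.subspace class_ring U (module_vec TYPE('a) n)"
    and "mat_rank (A * B) + vectorspace.dim class_ring (module_vec TYPE('a) n\<lparr>carrier := U\<rparr>) = mat_rank B"
proof -
  interpret N: vec_space "TYPE('a)" n .
  interpret M: vec_space "TYPE('a)" m .
  have R: "VectorSpace.subspace class_ring (mat_range B) N.V"
    using B by (rule subspace_mat_range)
  interpret T: linear_map class_ring "N.vs (mat_range B)" M.V "(*\<^sub>v) A"
    using A B by (rule linear_map_mat_range)
  have ker: "T.ker = U"
    unfolding T.ker_def U_def mat_kernel[OF A] using B
    by (auto simp: mat_range_def module_vec_simps)
  have im: "T.im = mat_range (A * B)"
    using mat_range_mult[OF A B] by (simp add: T.im_def)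
  \<comment> \<open>The kernel is known to be a submodule of the range of \<open>B\<close>. The
    operations there are those of the ambient space, so closure carries over.\<close>
  show "VectorSpace.subspace class_ring U N.V"
    using T.ker_is_submodule R vec_vs unfolding ker
    by (auto simp: VectorSpace.subspace_def submodule_def)
  have "vectorspace.fin_dim class_ring (N.vs (mat_range B))"
    using N.fin_dim R by (rule N.fin_dim_subspace)
  from T.rank_nullity[OF this]
  show "mat_rank (A * B) + vectorspace.dim class_ring (N.vs U) = mat_rank B"
    unfolding ker im mat_rank_eq_dim_mat_range[OF B] mat_rank_eq_dim_mat_range[OF mult_carrier_mat[OF A B]] by simp
qed

theorem theorem4:
  fixes A B C :: "'a::field mat"
    and m n p q :: nat
  assumes "A \<in> carrier_mat m n"
    and "B \<in> carrier_mat n p"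
    and "C \<in> carrier_mat p q"
  shows "mat_rank (A * B * C) + mat_rank B = mat_rank (A * B) + mat_rank (B * C) \<longleftrightarrow>
    mat_range B \<inter> mat_kernel A = mat_range (B * C) \<inter> mat_kernel A"
proof -
  interpret N: vec_space "TYPE('a)" n .
  have BC: "B * C \<in> carrier_mat n q"
    using assms by simp
  let ?U = "mat_range (B * C) \<inter> mat_kernel A" and ?W = "mat_range B \<inter> mat_kernel A"
  note U = rank_mult_add_dim_range_inter_kernel[OF assms(1) BC]
  note W = rank_mult_add_dim_range_inter_kernel[OF assms(1,2)]
  \<comment> \<open>Reassociating lets \<open>B * C\<close> take the place of \<open>B\<close> in
    the rank identity.\<close>
  have "A * B * C = A * (B * C)"
    using assms by (rule assoc_mult_mat)
  then have "mat_rank (A * B * C) + mat_rank B = mat_rank (A * B) + mat_rank (B * C) \<longleftrightarrow>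
      vectorspace.dim class_ring (N.vs ?U) = vectorspace.dim class_ring (N.vs ?W)"
    \<comment> \<open>Substituting for \<open>mat_rank B\<close> and \<open>mat_rank (B * C)\<close>
      puts the ranks of \<open>A * B\<close> and \<open>A * (B * C)\<close> on both sides, where
      they cancel. The additive form avoids truncated subtraction.\<close>
    using U(2) W(2) by (simp only:) linarith
  also have "\<dots> \<longleftrightarrow> ?U = ?W"
    using N.fin_dim U(1) W(1)
  proof (rule N.dim_eq_iff_if_subset)
    show "?U \<subseteq> ?W"
      using mat_range_mult_subset[OF assms(2,3)] by blast
  qed
  finally show ?thesis
    unfolding eq_commute[of ?U ?W] .
qed

end
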